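(* Let $h_1\ge h_2\ge\dots\ge h_n>0$ be integers. If a $\mathrm{LS}(h_1\dots h_n)$ exists, then a $\mathrm{LC}(h_1\dots h_n)$ exists.
   Context: Let $N=h_1+\dots+h_n$. A latin square of order $N$ is an $N\times N$ array on $N$ symbols in which each symbol occurs exactly once in each row and column; a subsquare is an $m\times m$ subarray (rows and columns from chosen $m$-sets) that is itself a latin square of order $m$; subsquares are disjoint if they share no row, column or symbol. A $\mathrm{LS}(h_1\dots h_n)$ (2-realization) is a latin square of order $N$ with pairwise disjoint subsquares of orders $h_1,\dots,h_n$. A latin cube of order $N$ is an $N\times N\times N$ array on $N$ symbols such that any two cells whose coordinates differ in exactly one position contain different symbols; a subcube is an $m\times m\times m$ subarray (indices in each coordinate from chosen $m$-sets) that is itself a latin cube of order $m$; subcubes are disjoint if they share no row, column, file (i.e. no index in any coordinate) or symbol. A $\mathrm{LC}(h_1\dots h_n)$ (3-realization) is a latin cube of order $N$ with pairwise disjoint subcubes of orders $h_1,\dots,h_n$. *)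

theory Defs
  imports Main "HOL-Library.Disjoint_Sets"
begin

(* An array is a total function; only its values on the index sets R, C (and F) are
   meaningful.  S is the set of symbols.  Carrying the index and symbol sets
   explicitly lets the same predicate describe subarrays. *)

definition latin_square ::
  "nat \<Rightarrow> nat set \<Rightarrow> nat set \<Rightarrow> nat set \<Rightarrow> (nat \<Rightarrow> nat \<Rightarrow> nat) \<Rightarrow> bool" where
  "latin_square m R C S L \<longleftrightarrow>
     finite R \<and> card R = m \<and> finite C \<and> card C = m \<and> finite S \<and> card S = m \<and>
     (\<forall>r\<in>R. \<forall>c\<in>C. L r c \<in> S) \<and>
     (\<forall>r\<in>R. \<forall>s\<in>S. \<exists>!c. c \<in> C \<and> L r c = s) \<and>
     (\<forall>c\<in>C. \<forall>s\<in>S. \<exists>!r. r \<in> R \<and> L r c = s)"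

definition latin_cube ::
  "nat \<Rightarrow> nat set \<Rightarrow> nat set \<Rightarrow> nat set \<Rightarrow> nat set \<Rightarrow> (nat \<Rightarrow> nat \<Rightarrow> nat \<Rightarrow> nat) \<Rightarrow> bool" where
  "latin_cube m R C F S Q \<longleftrightarrow>
     finite R \<and> card R = m \<and> finite C \<and> card C = m \<and>
     finite F \<and> card F = m \<and> finite S \<and> card S = m \<and>
     (\<forall>r\<in>R. \<forall>c\<in>C. \<forall>f\<in>F. Q r c f \<in> S) \<and>
     (\<forall>r\<in>R. \<forall>r'\<in>R. \<forall>c\<in>C. \<forall>f\<in>F. r \<noteq> r' \<longrightarrow> Q r c f \<noteq> Q r' c f) \<and>
     (\<forall>r\<in>R. \<forall>c\<in>C. \<forall>c'\<in>C. \<forall>f\<in>F. c \<noteq> c' \<longrightarrow> Q r c f \<noteq> Q r c' f) \<and>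
     (\<forall>r\<in>R. \<forall>c\<in>C. \<forall>f\<in>F. \<forall>f'\<in>F. f \<noteq> f' \<longrightarrow> Q r c f \<noteq> Q r c f')"

(* The type h_1 ... h_n is the list h, with order N = sum_list h; rows, columns, files and
   symbols are numbered 0, ..., N - 1.  The i-th subarray occupies the index sets R i, C i
   (and F i) and has symbol set S i. *)

definition LS :: "nat list \<Rightarrow> (nat \<Rightarrow> nat \<Rightarrow> nat) \<Rightarrow> bool" where
  "LS h L \<longleftrightarrow>
     (let N = sum_list h; n = length h in
       latin_square N {..<N} {..<N} {..<N} L \<and>
       (\<exists>R C S.
          (\<forall>i<n. R i \<subseteq> {..<N} \<and> C i \<subseteq> {..<N} \<and> S i \<subseteq> {..<N} \<and>
                 latin_square (h ! i) (R i) (C i) (S i) L) \<and>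
          disjoint_family_on R {..<n} \<and> disjoint_family_on C {..<n} \<and>
          disjoint_family_on S {..<n}))"

definition LC :: "nat list \<Rightarrow> (nat \<Rightarrow> nat \<Rightarrow> nat \<Rightarrow> nat) \<Rightarrow> bool" where
  "LC h Q \<longleftrightarrow>
     (let N = sum_list h; n = length h in
       latin_cube N {..<N} {..<N} {..<N} {..<N} Q \<and>
       (\<exists>R C F S.
          (\<forall>i<n. R i \<subseteq> {..<N} \<and> C i \<subseteq> {..<N} \<and> F i \<subseteq> {..<N} \<and> S i \<subseteq> {..<N} \<and>
                 latin_cube (h ! i) (R i) (C i) (F i) (S i) Q) \<and>
          disjoint_family_on R {..<n} \<and> disjoint_family_on C {..<n} \<and>
          disjoint_family_on F {..<n} \<and> disjoint_family_on S {..<n}))"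

end

theory Submission
  imports Defs
begin

text \<open>Let \<open>\<sigma>\<close> be a permutation taking the symbol set of each subsquare of \<open>L\<close> to its row set; it
  exists because, by their sizes, the symbol sets and the row sets both partition the ground set.
  Then \<open>(x, y, z) \<mapsto> L (\<sigma> (L x y)) z\<close> is a latin cube, and the same argument applied to each
  subsquare shows that it contains the required subcubes.\<close>

text \<open>With two coordinates fixed, the third enters through a composition of injections: lines
  of \<open>L\<close>, with \<open>\<sigma>\<close> turning the inner symbol into a row index. As
  \<open>z\<close> is a column index of \<open>L\<close>, the files reuse \<open>C\<close>.
  Arbitrary index sets let this cover the whole square and its subsquares alike.\<close>

lemma latin_square_imp_latin_cube:
  assumes L: "latin_square m R C S L" and \<sigma>: "bij_betw \<sigma> S R"
  shows "latin_cube m R C C S (\<lambda>x y z. L (\<sigma> (L x y)) z)"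
proof -
  have mem: "L r c \<in> S" if "r \<in> R" "c \<in> C" for r c
    using L that unfolding latin_square_def by blast
  have row: "c = c'" if "r \<in> R" "c \<in> C" "c' \<in> C" "L r c = L r c'" for r c c'
    using L that mem unfolding latin_square_def by metis
  have col: "r = r'" if "r \<in> R" "r' \<in> R" "c \<in> C" "L r c = L r' c" for r r' c
    using L that mem unfolding latin_square_def by metis
  have \<sigma>_mem: "\<sigma> s \<in> R" if "s \<in> S" for s
    using \<sigma> that by (rule bij_betw_apply)
  have \<sigma>_inj: "s = t" if "s \<in> S" "t \<in> S" "\<sigma> s = \<sigma> t" for s t
    using \<sigma> that by (auto simp: bij_betw_def dest: inj_onD)
  have "finite R \<and> card R = m \<and> finite C \<and> card C = m \<and> finite S \<and> card S = m"
    using L unfolding latin_square_def by simp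
  moreover have "\<forall>r\<in>R. \<forall>c\<in>C. \<forall>f\<in>C. L (\<sigma> (L r c)) f \<in> S"
    by (simp add: mem \<sigma>_mem)
  moreover have "\<forall>r\<in>R. \<forall>r'\<in>R. \<forall>c\<in>C. \<forall>f\<in>C. r \<noteq> r' \<longrightarrow> L (\<sigma> (L r c)) f \<noteq> L (\<sigma> (L r' c)) f"
    by (meson col \<sigma>_inj \<sigma>_mem mem)
  \<comment> \<open>Peel from outside: \<open>col\<close> in column \<open>f\<close> equates the two
    rows, \<open>\<sigma>_inj\<close> the inner symbols, and \<open>row\<close> then gives
    \<open>c = c'\<close>.\<close>
  moreover have "\<forall>r\<in>R. \<forall>c\<in>C. \<forall>c'\<in>C. \<forall>f\<in>C. c \<noteq> c' \<longrightarrow> L (\<sigma> (L r c)) f \<noteq> L (\<sigma> (L r c')) f"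
    by (meson row col \<sigma>_inj \<sigma>_mem mem)
  moreover have "\<forall>r\<in>R. \<forall>c\<in>C. \<forall>f\<in>C. \<forall>f'\<in>C. f \<noteq> f' \<longrightarrow> L (\<sigma> (L r c)) f \<noteq> L (\<sigma> (L r c)) f'"
    by (meson row \<sigma>_mem mem)
  ultimately show ?thesis
    unfolding latin_cube_def by simp
qed

text \<open>Bijections chosen block by block are glued. Disjointness of the \<open>A i\<close> makes
  the gluing well defined; disjointness of the images \<open>B i\<close> keeps it injective across
  blocks.\<close>

lemma ex_bij_betw_disjoint_families:
  assumes "disjoint_family_on A I" "disjoint_family_on B I"
    and "\<And>i. i \<in> I \<Longrightarrow> finite (A i)" "\<And>i. i \<in> I \<Longrightarrow> finite (B i)"
    and "\<And>i. i \<in> I \<Longrightarrow> card (A i) = card (B i)"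
  obtains f where "bij_betw f (\<Union>i\<in>I. A i) (\<Union>i\<in>I. B i)" "\<And>i. i \<in> I \<Longrightarrow> bij_betw f (A i) (B i)"
proof -
  have "\<forall>i\<in>I. \<exists>g. bij_betw g (A i) (B i)"
    using assms by (meson finite_same_card_bij)
  then obtain g where g: "\<And>i. i \<in> I \<Longrightarrow> bij_betw (g i) (A i) (B i)"
    by metis
  \<comment> \<open>The description picks the unique block containing \<open>x\<close>; values
    outside the union are irrelevant.\<close>
  define f where "f x = g (THE i. i \<in> I \<and> x \<in> A i) x" for x
  have f_eq: "f x = g i x" if "i \<in> I" "x \<in> A i" for i x
  proof -
    have "(THE i. i \<in> I \<and> x \<in> A i) = i"
      using that assms(1) by (intro the_equality) (auto simp: disjoint_family_on_def)
    then show ?thesis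
      by (simp add: f_def)
  qed
  have f: "bij_betw f (A i) (B i)" if "i \<in> I" for i
    using g[OF that] f_eq[OF that] by (simp cong: bij_betw_cong)
  moreover have "bij_betw f (\<Union>i\<in>I. A i) (\<Union>i\<in>I. B i)"
    using assms(2) f by (rule bij_betw_UNION_disjoint)
  ultimately show ?thesis
    using that by blast
qed

text \<open>By disjointness the cardinalities add up to that of the finite ground set, so the union
  cannot be a proper subset.\<close>

lemma UN_disjoint_family_eq_lessThan_sum_list:
  fixes h :: "nat list"
  assumes "disjoint_family_on A {..<length h}"
    and "\<And>i. i < length h \<Longrightarrow> A i \<subseteq> {..<sum_list h}" "\<And>i. i < length h \<Longrightarrow> card (A i) = h ! i"
  shows "(\<Union>i<length h. A i) = {..<sum_list h}"
proof (rule card_subset_eq)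
  show "(\<Union>i<length h. A i) \<subseteq> {..<sum_list h}"
    using assms(2) by blast
  have "finite (A i)" if "i < length h" for i
    using assms(2)[OF that] by (rule finite_subset) simp
  then have "card (\<Union>i<length h. A i) = (\<Sum>i<length h. card (A i))"
    using assms(1) by (intro card_UN_disjoint') auto
  also have "\<dots> = card {..<sum_list h}"
    using assms(3) by (simp add: sum_list_sum_nth atLeast0LessThan)
  finally show "card (\<Union>i<length h. A i) = card {..<sum_list h}" .
qed simp

theorem theorem8:
  fixes h :: "nat list"
  assumes "sorted_wrt (\<ge>) h"
    and "\<forall>m\<in>set h. m > 0"
    and "\<exists>L. LS h L"
  shows "\<exists>Q. LC h Q"
proof -
  let ?N = "sum_list h" and ?n = "length h"
  obtain L R C S where L: "latin_square ?N {..<?N} {..<?N} {..<?N} L"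
    and sub: "\<And>i. i < ?n \<Longrightarrow> R i \<subseteq> {..<?N} \<and> C i \<subseteq> {..<?N} \<and> S i \<subseteq> {..<?N} \<and>
        latin_square (h ! i) (R i) (C i) (S i) L"
    and disj: "disjoint_family_on R {..<?n}" "disjoint_family_on C {..<?n}"
      "disjoint_family_on S {..<?n}"
    using assms(3) unfolding LS_def Let_def by blast
  have size: "finite (R i)" "card (R i) = h ! i" "finite (S i)" "card (S i) = h ! i"
    if "i < ?n" for i
    using sub[OF that] unfolding latin_square_def by blast+
  obtain \<sigma> where \<sigma>: "bij_betw \<sigma> (\<Union>i<?n. S i) (\<Union>i<?n. R i)"
    and \<sigma>_sub: "\<And>i. i \<in> {..<?n} \<Longrightarrow> bij_betw \<sigma> (S i) (R i)"
    using size by (auto intro: ex_bij_betw_disjoint_families[OF disj(3,1)])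
  have "(\<Union>i<?n. S i) = {..<?N}" "(\<Union>i<?n. R i) = {..<?N}"
    using disj sub size by (simp_all add: UN_disjoint_family_eq_lessThan_sum_list)
  with \<sigma> have "bij_betw \<sigma> {..<?N} {..<?N}"
    by simp
  \<comment> \<open>The subcubes lie on \<open>R i\<close>, \<open>C i\<close>, \<open>C i\<close>
    with symbols \<open>S i\<close>: the witness \<open>C\<close> serves for both columns and files,
    so its disjointness is used for both.\<close>
  then have "LC h (\<lambda>x y z. L (\<sigma> (L x y)) z)"
    unfolding LC_def Let_def
    using L sub disj \<sigma>_sub
    by (intro conjI exI[of _ R] exI[of _ C] exI[of _ S] allI impI latin_square_imp_latin_cube) auto
  then show ?thesis
    by blast
qed

end
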